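(* For every $n\ge 1$ and all strings $x_1^n\in\mathbb{X}^n$ and symbols $x_{n+1}\in\mathbb{X}$, $$-\log\mathrm{PPM}(x_1^n)\le 2\log(n+1)+n\log D,$$ $$-\log\mathrm{PPM}(x_{n+1}|x_1^n)\le 3\log(n+D).$$
   Context: $\mathbb{X}=\{a_1,\dots,a_D\}$ is a finite alphabet, $D\ge 2$; $x_j^k:=(x_j,\dots,x_k)$, the empty string if $k=j-1$; $\log$ is the binary logarithm. The frequency of a substring $w_1^k$ in $x_1^n$ is $N(w_1^k|x_1^n):=\sum_{i=1}^{n-k+1}\mathbf{1}\{x_i^{i+k-1}=w_1^k\}$ (for $k=0$ this equals $n+1$). For $k\ge 0$, $$\mathrm{PPM}_k(x_1^n):=\begin{cases}D^{-k-1}\prod_{i=k+2}^n\dfrac{N(x_{i-k}^i|x_1^{i-1})+1}{N(x_{i-k}^{i-1}|x_1^{i-2})+D},& k\le n-2,\\ D^{-n},& k\ge n-1,\end{cases}$$ and $$\mathrm{PPM}(x_1^n):=\sum_{k=0}^\infty\left[\frac1{k+1}-\frac1{k+2}\right]\mathrm{PPM}_k(x_1^n).$$ The conditional probability is $\mathrm{PPM}(x_{n+1}|x_1^n):=\mathrm{PPM}(x_1^{n+1})/\mathrm{PPM}(x_1^n)$. *)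

theory Defs
  imports Complex_Main "HOL-Library.Cardinality"
begin

text \<open>The alphabet is a finite type and \<open>D\<close> is its cardinality. Strings are lists, with
  positions counted from 1.\<close>

definition substr :: "'a list \<Rightarrow> nat \<Rightarrow> nat \<Rightarrow> 'a list" where
  "substr x j k = take (k + 1 - j) (drop (j - 1) x)"

text \<open>The upper bound is \<open>n + 1 - k\<close> rather than \<open>n - k + 1\<close>, so that the truncated subtraction
  on \<^typ>\<open>nat\<close> yields an empty sum for \<open>k = n + 1\<close>.\<close>

definition freq :: "'a list \<Rightarrow> 'a list \<Rightarrow> nat" where
  "freq w x = (\<Sum>i = 1..length x + 1 - length w. of_bool (substr x i (i + length w - 1) = w))"

text \<open>The condition \<open>k \<le> n - 2\<close> (over the integers) is written \<open>k + 2 \<le> n\<close>.\<close>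

definition ppm_order :: "nat \<Rightarrow> 'a::finite list \<Rightarrow> real" where
  "ppm_order k x =
    (if k + 2 \<le> length x
     then 1 / real CARD('a) ^ (k + 1) *
       (\<Prod>i = k + 2..length x.
         (real (freq (substr x (i - k) i) (substr x 1 (i - 1))) + 1) /
         (real (freq (substr x (i - k) (i - 1)) (substr x 1 (i - 2))) + real CARD('a)))
     else 1 / real CARD('a) ^ length x)"

definition ppm :: "'a::finite list \<Rightarrow> real" where
  "ppm x = (\<Sum>k. (1 / (real k + 1) - 1 / (real k + 2)) * ppm_order k x)"

definition ppm_cond :: "'a::finite \<Rightarrow> 'a list \<Rightarrow> real" where
  "ppm_cond a x = ppm (x @ [a]) / ppm x"

end

theory Submission
  imports Defs
begin

text \<open>For the first bound a single term of the mixture suffices, since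
  \<open>ppm_order k x\<close> is uniform for \<open>k \<ge> length x - 1\<close>. For the second, appending a symbol to a string
  of length \<open>n\<close> multiplies each \<open>ppm_order k\<close> either by \<open>1 / D\<close> or by one more factor of the
  product, whose denominator is at most \<open>n + D\<close> because a string of length \<open>n - 1\<close> has at most
  \<open>n\<close> occurrences of any word. Hence the conditional probability is even at least
  \<open>1 / (n + D)\<close>.\<close>

text \<open>The sum of indicators has at most \<open>length x + 1\<close> terms; the empty word
  attains this.\<close>

lemma freq_le: "freq w x \<le> length x + 1"
proof -
  have "freq w x \<le> (\<Sum>i = 1..length x + 1 - length w. 1)"
    unfolding freq_def by (intro sum_mono) simp
  then show ?thesis by simp
qed

lemma length_substr_le: "length (substr x 1 j) \<le> j"
  by (simp add: substr_def)

lemma substr_append: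
  assumes "1 \<le> j" "k \<le> length x"
  shows "substr (x @ y) j k = substr x j k"
  using assms by (cases "j - 1 \<le> length x") (simp_all add: substr_def)

lemma ppm_order_pos: "ppm_order k (x :: 'a::finite list) > 0"
  by (auto simp: ppm_order_def intro!: prod_pos divide_pos_pos mult_pos_pos add_nonneg_pos)

lemma ppm_order_large: "length x < k + 2 \<Longrightarrow> ppm_order k (x :: 'a::finite list) = 1 / real CARD('a) ^ length x"
  by (simp add: ppm_order_def)

text \<open>The factor does not depend on \<open>k\<close>, so it can be pulled out of the mixture
  over all orders.\<close>

lemma ppm_order_snoc_ge:
  fixes x :: "'a::finite list"
  shows "ppm_order k x / real (length x + CARD('a)) \<le> ppm_order k (x @ [a])"
\<comment> \<open>This decides whether the extended string, of length \<open>length x + 1\<close>,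
  falls under the product formula.\<close>
proof (cases "k < length x")
  case True
  define F where "F y i = (real (freq (substr y (i - k) i) (substr y 1 (i - 1))) + 1) /
    (real (freq (substr y (i - k) (i - 1)) (substr y 1 (i - 2))) + real CARD('a))"
    for y :: "'a list" and i
  let ?n = "length x" and ?D = "real CARD('a)"
  let ?P = "1 / ?D ^ (k + 1) * (\<Prod>i = k + 2..?n. F x i)"
  \<comment> \<open>The product formula persists at the boundary \<open>?n = k + 1\<close>: the
    product is empty and the uniform value is the same power of \<open>?D\<close>.\<close>
  have old: "ppm_order k x = ?P"
  proof (cases "k + 2 \<le> ?n")
    case False
    with True have "?n = k + 1" by simp
    then show ?thesis by (simp add: ppm_order_def)
  qed (simp add: ppm_order_def F_def)
  have "(\<Prod>i = k + 2..?n + 1. F (x @ [a]) i) = (\<Prod>i = k + 2..?n. F (x @ [a]) i) * F (x @ [a]) (?n + 1)"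
    using True by simp
  \<comment> \<open>For \<open>i \<le> ?n\<close> every substring in the factor lies inside
    \<open>x\<close>.\<close>
  also have "(\<Prod>i = k + 2..?n. F (x @ [a]) i) = (\<Prod>i = k + 2..?n. F x i)"
    by (intro prod.cong) (auto simp: F_def substr_append)
  finally have new: "ppm_order k (x @ [a]) = ppm_order k x * F (x @ [a]) (?n + 1)"
    using True unfolding old by (simp add: ppm_order_def F_def)
  let ?N = "freq (substr (x @ [a]) (?n + 1 - k) ?n) (substr (x @ [a]) 1 (?n - 1))"
  \<comment> \<open>The searched prefix has length at most \<open>?n - 1\<close>, where
    \<open>?n \<ge> 1\<close> because \<open>k < ?n\<close>.\<close>
  have "?N \<le> ?n"
    using freq_le[of "substr (x @ [a]) (?n + 1 - k) ?n" "substr (x @ [a]) 1 (?n - 1)"]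
      length_substr_le[of "x @ [a]" "?n - 1"] True by linarith
  then have "1 / real (?n + CARD('a)) \<le> F (x @ [a]) (?n + 1)"
    by (auto simp: F_def intro!: frac_le add_nonneg_pos)
  then show ?thesis
    using mult_left_mono[OF _ less_imp_le[OF ppm_order_pos[of k x]]] unfolding new by fastforce
next
  case False
  \<comment> \<open>Here both strings get the uniform value, so the exact ratio is
    \<open>1 / CARD('a)\<close>.\<close>
  have "1 / real CARD('a) ^ length x / real (length x + CARD('a))
      \<le> 1 / real CARD('a) ^ length x / real CARD('a)"
    by (intro divide_left_mono) (auto intro!: mult_pos_pos add_nonneg_pos)
  with False show ?thesis
    by (simp add: ppm_order_large field_simps)
qed

lemma ppm_weight_pos: "1 / (real k + 1) - 1 / (real k + 2) > 0"
  using frac_less2[of 1 1 "real k + 1" "real k + 2"] by simp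

lemma summable_ppm_weight: "summable (\<lambda>k. 1 / (real k + 1) - 1 / (real k + 2))"
proof -
  have "(\<lambda>k. 1 / (real k + 1)) \<longlonglongrightarrow> 0"
    using LIMSEQ_inverse_real_of_nat by (simp add: inverse_eq_divide add.commute)
  from telescope_summable'[OF this] show ?thesis
    by (simp add: add.commute)
qed

text \<open>For large \<open>k\<close> the value \<open>ppm_order k x\<close> is constant, so the
  series is eventually a multiple of the telescoping series of weights.\<close>

lemma summable_ppm:
  "summable (\<lambda>k. (1 / (real k + 1) - 1 / (real k + 2)) * ppm_order k (x :: 'a::finite list))"
proof -
  have "\<forall>\<^sub>F k in sequentially. (1 / (real k + 1) - 1 / (real k + 2)) * ppm_order k x
      = (1 / (real k + 1) - 1 / (real k + 2)) * (1 / real CARD('a) ^ length x)"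
    using eventually_ge_at_top[of "length x"] by eventually_elim (simp add: ppm_order_large)
  then show ?thesis
    using summable_mult2[OF summable_ppm_weight] by (simp only: summable_cong)
qed

lemma ppm_ge_term: "(1 / (real k + 1) - 1 / (real k + 2)) * ppm_order k x \<le> ppm x"
proof -
  have "0 \<le> (1 / (real j + 1) - 1 / (real j + 2)) * ppm_order j x" for j
    by (intro mult_nonneg_nonneg less_imp_le ppm_weight_pos ppm_order_pos)
  then show ?thesis
    unfolding ppm_def using sum_le_suminf[OF summable_ppm, of "{k}" x] by simp
qed

lemma ppm_pos: "ppm x > 0"
  using ppm_ge_term[of 0 x] ppm_weight_pos[of 0] ppm_order_pos[of 0 x]
  by (meson less_le_trans mult_pos_pos)

text \<open>The term used is \<open>k = length x - 1\<close>, the smallest order in the uniform case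
  and hence the one of largest weight, \<open>1 / (n * (n + 1))\<close> with
  \<open>n = length x\<close>.\<close>

lemma ppm_ge:
  fixes x :: "'a::finite list"
  assumes "x \<noteq> []"
  shows "1 / ((real (length x) + 1)^2 * real CARD('a) ^ length x) \<le> ppm x"
proof -
  let ?n = "length x"
  have n: "?n \<ge> 1" using assms by (cases x) auto
  have "1 / (real ?n + 1)^2 \<le> 1 / (real ?n * (real ?n + 1))"
    using n by (intro frac_le mult_pos_pos) (auto simp: power2_eq_square)
  also have "\<dots> = 1 / (real (?n - 1) + 1) - 1 / (real (?n - 1) + 2)"
    using n assms by (simp add: of_nat_diff divide_simps)
  finally have "1 / (real ?n + 1)^2 * (1 / real CARD('a) ^ ?n)
      \<le> (1 / (real (?n - 1) + 1) - 1 / (real (?n - 1) + 2)) * ppm_order (?n - 1) x"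
    using n by (subst ppm_order_large) (simp, rule mult_right_mono, simp_all)
  then show ?thesis using ppm_ge_term[of "?n - 1" x] by simp
qed

lemma ppm_cond_ge: "1 / real (length x + CARD('a)) \<le> ppm_cond a (x :: 'a::finite list)"
proof -
  let ?c = "1 / real (length x + CARD('a))"
  let ?w = "\<lambda>k. 1 / (real k + 1) - 1 / (real k + 2)"
  have "?c * ppm x = (\<Sum>k. ?c * (?w k * ppm_order k x))"
    unfolding ppm_def by (rule suminf_mult[symmetric, OF summable_ppm])
  also have "\<dots> \<le> ppm (x @ [a])"
    unfolding ppm_def
  proof (rule suminf_le)
    fix k
    show "?c * (?w k * ppm_order k x) \<le> ?w k * ppm_order k (x @ [a])"
      using mult_left_mono[OF ppm_order_snoc_ge[of k x a] less_imp_le[OF ppm_weight_pos[of k]]]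
      by (simp add: mult_ac)
  qed (intro summable_mult summable_ppm)+
  finally show ?thesis
    unfolding ppm_cond_def using ppm_pos[of x] by (simp only: pos_le_divide_eq)
qed

theorem theorem13:
  fixes x :: "'a::finite list" and a :: 'a and n :: nat
  assumes "CARD('a) \<ge> 2" and "n \<ge> 1" and "length x = n"
  shows "- log 2 (ppm x) \<le> 2 * log 2 (real n + 1) + real n * log 2 (real CARD('a)) \<and>
         - log 2 (ppm_cond a x) \<le> 3 * log 2 (real n + real CARD('a))"
proof
  let ?D = "real CARD('a)"
  have D: "?D > 0" by simp
  have "x \<noteq> []" using assms(2,3) by auto
  have "log 2 (1 / ((real n + 1)^2 * ?D ^ n)) \<le> log 2 (ppm x)"
    using ppm_ge[OF \<open>x \<noteq> []\<close>] assms(3) D by (intro log_mono) (auto intro!: divide_pos_pos)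
  moreover have "log 2 (1 / ((real n + 1)^2 * ?D ^ n)) = - (2 * log 2 (real n + 1) + real n * log 2 ?D)"
    using D by (simp add: log_divide log_mult log_nat_power)
  ultimately show "- log 2 (ppm x) \<le> 2 * log 2 (real n + 1) + real n * log 2 ?D"
    by linarith
  have "log 2 (1 / (real n + ?D)) \<le> log 2 (ppm_cond a x)"
    using ppm_cond_ge[of x a] assms(3) D by (intro log_mono) (auto intro: add_nonneg_pos)
  moreover have "log 2 (1 / (real n + ?D)) = - log 2 (real n + ?D)"
    by (simp flip: inverse_eq_divide add: log_inverse)
  \<comment> \<open>The estimate so far has coefficient 1; nonnegativity of the logarithm weakens it
    to 3.\<close>
  moreover have "log 2 (real n + ?D) \<ge> 0"
    using assms by (intro zero_le_log_cancel_iff[THEN iffD2]) auto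
  ultimately show "- log 2 (ppm_cond a x) \<le> 3 * log 2 (real n + ?D)"
    by linarith
qed

end
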